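(* Let $x_j$ be any location with its $5$-point global stencil $S^5$, let $\omega_0^{\mathrm{JS}},\omega_1^{\mathrm{JS}},\omega_2^{\mathrm{JS}}$ be the WENO-JS weights on $S^5$, and let $\big(g^{\mathrm{GMX}}\big)_k$, $k=0,1,2$, be the generalized mapping functions of a WENO-Z-type scheme WENO-X on $S^5$. Let $\big(g^{\mathrm{LOP-GMX}}\big)_k(\omega_k^{\mathrm{JS}})$, $k=0,1,2$, be the output of the LOP algorithm described in the context. Then the set of mapping functions $\big\{\big(g^{\mathrm{LOP-GMX}}\big)_k(\omega_k^{\mathrm{JS}}),\ k=0,1,2\big\}$ is locally order-preserving (LOP); that is, for all $a,b\in\{0,1,2\}$: (i) if $\omega_a^{\mathrm{JS}}>\omega_b^{\mathrm{JS}}$, then $\big(g^{\mathrm{LOP-GMX}}\big)_a(\omega_a^{\mathrm{JS}})\ge \big(g^{\mathrm{LOP-GMX}}\big)_b(\omega_b^{\mathrm{JS}})$; (ii) if $\omega_a^{\mathrm{JS}}=\omega_b^{\mathrm{JS}}$, then $\big(g^{\mathrm{LOP-GMX}}\big)_a(\omega_a^{\mathrm{JS}})= \big(g^{\mathrm{LOP-GMX}}\big)_b(\omega_b^{\mathrm{JS}})$.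
   Context: **WENO-JS weights.** The stencil $S^5$ at $x_j$ carries real cell averages $\bar u_{j-2},\bar u_{j-1},\bar u_j,\bar u_{j+1},\bar u_{j+2}$ and is divided into three $3$-point substencils $S_0,S_1,S_2$, where $S_k=\{I_{j+k-2},I_{j+k-1},I_{j+k}\}$ and $I_i$ is the $i$-th cell. The smoothness indicators are $$IS_0=\tfrac{13}{12}(\bar u_{j-2}-2\bar u_{j-1}+\bar u_j)^2+\tfrac14(\bar u_{j-2}-4\bar u_{j-1}+3\bar u_j)^2,$$ $$IS_1=\tfrac{13}{12}(\bar u_{j-1}-2\bar u_{j}+\bar u_{j+1})^2+\tfrac14(\bar u_{j-1}-\bar u_{j+1})^2,$$ $$IS_2=\tfrac{13}{12}(\bar u_{j}-2\bar u_{j+1}+\bar u_{j+2})^2+\tfrac14(3\bar u_{j}-4\bar u_{j+1}+\bar u_{j+2})^2.$$ With ideal weights $d_0=0.1$, $d_1=0.6$, $d_2=0.3$ and a fixed small $\epsilon>0$, set $$\alpha_k^{\mathrm{JS}}=\frac{d_k}{(\epsilon+IS_k)^2},\qquad \omega_k^{\mathrm{JS}}=\frac{\alpha_k^{\mathrm{JS}}}{\sum_{l=0}^2\alpha_l^{\mathrm{JS}}},\qquad k=0,1,2.$$ **Generalized mapping functions.** For a WENO-Z-type scheme WENO-X, the unnormalized weights are written as $$\alpha_k^{\mathrm{X}}=\big(g^{\mathrm{GMX}}\big)_k(\omega_k^{\mathrm{JS}})=\lambda_{1}^{\mathrm{X}}(d_k)+\lambda_{2}^{\mathrm{X}}(d_k)\,\omega_k^{\mathrm{JS}},\qquad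 k=0,1,2,$$ where the coefficients $\lambda_1^{\mathrm X}(d_k),\lambda_2^{\mathrm X}(d_k)$ are real numbers determined by the scheme X, depending on $k$ and on the stencil data. The function $\big(g^{\mathrm{GMX}}\big)_k$ is called the generalized mapping function of WENO-X. **Index and admissible pairs.** For $a,b\in\{0,1,2\}$ put $$\mathbf{LOP\_idx}(a,b,\mathrm X)=\big(\omega_a^{\mathrm{JS}}-\omega_b^{\mathrm{JS}}\big)\Big(\big(g^{\mathrm{GMX}}\big)_a(\omega_a^{\mathrm{JS}})-\big(g^{\mathrm{GMX}}\big)_b(\omega_b^{\mathrm{JS}})\Big).$$ The condition $\mathbf{LOP\_idx}(a,b,\mathrm X)\in\mathbb S^{\mathrm X}$ means that either $\mathbf{LOP\_idx}(a,b,\mathrm X)>0$, or $\omega_a^{\mathrm{JS}}-\omega_b^{\mathrm{JS}}=\big(g^{\mathrm{GMX}}\big)_a(\omega_a^{\mathrm{JS}})-\big(g^{\mathrm{GMX}}\big)_b(\omega_b^{\mathrm{JS}})=0$. **LOP algorithm.** The algorithm runs through the pairs $(s_1,s_2)$ with $0\le s_1<s_2\le 2$ and tests whether $\mathbf{LOP\_idx}(s_1,s_2,\mathrm X)\in\mathbb S^{\mathrm X}$. If the test succeeds for every pair, it sets $\lambda=1$; as soon as the test fails for some pair, it sets $\lambda=0$ and stops testing. Then, for each $k=0,1,2$, it outputs $$\big(g^{\mathrm{LOP-GMX}}\big)_k(\omega_k^{\mathrm{JS}})=\begin{cases}\big(g^{\mathrm{GMX}}\big)_k(\omega_k^{\mathrm{JS}}),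 & \lambda=1,\\ \alpha_k^{\mathrm{JS}}, & \lambda=0.\end{cases}$$ *)

theory Defs
  imports Complex_Main
begin

type_synonym stencil = "real \<times> real \<times> real \<times> real \<times> real"

text \<open>Indices \<open>k\<close> of substencils are natural numbers and only meaningful for \<open>k \<in> {0, 1, 2}\<close>;
  in the definitions by cases below, the last case stands for \<open>k = 2\<close>.\<close>

definition stencil_at :: "(int \<Rightarrow> real) \<Rightarrow> int \<Rightarrow> stencil" where
  "stencil_at u j = (u (j - 2), u (j - 1), u j, u (j + 1), u (j + 2))"

definition smoothness_indicator :: "stencil \<Rightarrow> nat \<Rightarrow> real" where
  "smoothness_indicator S k = (case S of (um2, um1, u0, up1, up2) \<Rightarrow>
     if k = 0 then 13/12 * (um2 - 2 * um1 + u0)^2 + 1/4 * (um2 - 4 * um1 + 3 * u0)^2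
     else if k = 1 then 13/12 * (um1 - 2 * u0 + up1)^2 + 1/4 * (um1 - up1)^2
     else 13/12 * (u0 - 2 * up1 + up2)^2 + 1/4 * (3 * u0 - 4 * up1 + up2)^2)"

definition ideal_weight :: "nat \<Rightarrow> real" where
  "ideal_weight k = (if k = 0 then 1/10 else if k = 1 then 6/10 else 3/10)"

definition alpha_JS :: "real \<Rightarrow> stencil \<Rightarrow> nat \<Rightarrow> real" where
  "alpha_JS \<epsilon> S k = ideal_weight k / (\<epsilon> + smoothness_indicator S k)^2"

definition omega_JS :: "real \<Rightarrow> stencil \<Rightarrow> nat \<Rightarrow> real" where
  "omega_JS \<epsilon> S k = alpha_JS \<epsilon> S k / (\<Sum>l=0..2. alpha_JS \<epsilon> S l)"

text \<open>A WENO-Z-type scheme enters only through its coefficients \<open>\<lambda>\<^sub>1(d\<^sub>k)\<close> and \<open>\<lambda>\<^sub>2(d\<^sub>k)\<close>, which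
  are arbitrary real functions of the stencil data and of \<open>k\<close>.\<close>

record wenoz_scheme =
  coeff1 :: "stencil \<Rightarrow> nat \<Rightarrow> real"
  coeff2 :: "stencil \<Rightarrow> nat \<Rightarrow> real"

definition g_GMX :: "wenoz_scheme \<Rightarrow> stencil \<Rightarrow> nat \<Rightarrow> real \<Rightarrow> real" where
  "g_GMX X S k w = coeff1 X S k + coeff2 X S k * w"

definition LOP_idx :: "real \<Rightarrow> stencil \<Rightarrow> nat \<Rightarrow> nat \<Rightarrow> wenoz_scheme \<Rightarrow> real" where
  "LOP_idx \<epsilon> S a b X =
     (omega_JS \<epsilon> S a - omega_JS \<epsilon> S b) *
     (g_GMX X S a (omega_JS \<epsilon> S a) - g_GMX X S b (omega_JS \<epsilon> S b))"

text \<open>The condition \<open>LOP_idx(a, b, X) \<in> \<S>\<^sup>X\<close>. It is a predicate on the pair \<open>(a, b)\<close>, because its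
  second alternative is not determined by the value of the index.\<close>

definition LOP_admissible :: "real \<Rightarrow> stencil \<Rightarrow> wenoz_scheme \<Rightarrow> nat \<times> nat \<Rightarrow> bool" where
  "LOP_admissible \<epsilon> S X = (\<lambda>(a, b).
     LOP_idx \<epsilon> S a b X > 0 \<or>
     (omega_JS \<epsilon> S a - omega_JS \<epsilon> S b = 0 \<and>
      g_GMX X S a (omega_JS \<epsilon> S a) - g_GMX X S b (omega_JS \<epsilon> S b) = 0))"

fun LOP_loop :: "('a \<Rightarrow> bool) \<Rightarrow> 'a list \<Rightarrow> nat" where
  "LOP_loop test [] = 1"
| "LOP_loop test (p # ps) = (if test p then LOP_loop test ps else 0)"

definition LOP_lambda :: "real \<Rightarrow> stencil \<Rightarrow> wenoz_scheme \<Rightarrow> nat" where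
  "LOP_lambda \<epsilon> S X = LOP_loop (LOP_admissible \<epsilon> S X) [(0, 1), (0, 2), (1, 2)]"

text \<open>The value \<open>(g\<^sup>L\<^sup>O\<^sup>P\<^sup>-\<^sup>G\<^sup>M\<^sup>X)\<^sub>k(\<omega>\<^sub>k\<^sup>J\<^sup>S)\<close>; the algorithm defines the mapping only at the
  JS weight itself.\<close>

definition g_LOP_GMX :: "real \<Rightarrow> stencil \<Rightarrow> wenoz_scheme \<Rightarrow> nat \<Rightarrow> real" where
  "g_LOP_GMX \<epsilon> S X k =
     (if LOP_lambda \<epsilon> S X = 1 then g_GMX X S k (omega_JS \<epsilon> S k) else alpha_JS \<epsilon> S k)"

text \<open>Here \<open>v k\<close> is the value of the \<open>k\<close>-th mapping function at the weight \<open>w k\<close>.\<close>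

definition locally_order_preserving :: "(nat \<Rightarrow> real) \<Rightarrow> (nat \<Rightarrow> real) \<Rightarrow> bool" where
  "locally_order_preserving w v \<longleftrightarrow>
     (\<forall>a\<in>{0, 1, 2}. \<forall>b\<in>{0, 1, 2}.
        (w a > w b \<longrightarrow> v a \<ge> v b) \<and> (w a = w b \<longrightarrow> v a = v b))"

end

theory Submission
  imports Defs
begin

text \<open>If some pair fails the test, the output is \<open>\<alpha>\<^sup>J\<^sup>S\<close>, a fixed positive multiple of
  \<open>\<omega>\<^sup>J\<^sup>S\<close>. Otherwise every pair is admissible, and a positive index means that the two
  differences have the same strict sign.\<close>

lemma smoothness_indicator_nonneg: "smoothness_indicator S k \<ge> 0"
  by (cases S) (simp add: smoothness_indicator_def)

lemma alpha_JS_pos: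
  assumes "\<epsilon> > 0"
  shows "alpha_JS \<epsilon> S k > 0"
proof -
  \<comment> \<open>All indicators vanish on constant data, so \<open>\<epsilon>\<close> alone must
    keep the denominator away from zero.\<close>
  have "\<epsilon> + smoothness_indicator S k > 0"
    using assms smoothness_indicator_nonneg[of S k] by linarith
  then show ?thesis
    by (simp add: alpha_JS_def ideal_weight_def)
qed

lemma LOP_loop_eq_1_iff: "LOP_loop test ps = 1 \<longleftrightarrow> (\<forall>p\<in>set ps. test p)"
  by (induction ps) auto

text \<open>The loop tests only pairs with \<open>a < b\<close>, while order preservation ranges
  over all pairs; reflexivity and symmetry supply the rest.\<close>

lemma LOP_admissible_refl: "LOP_admissible \<epsilon> S X (a, a)"
  by (simp add: LOP_admissible_def)

text \<open>Swapping the indices negates both factors of the index, so their product is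
  unchanged.\<close>

lemma LOP_admissible_sym:
  "LOP_admissible \<epsilon> S X (a, b) \<Longrightarrow> LOP_admissible \<epsilon> S X (b, a)"
  by (auto simp: LOP_admissible_def LOP_idx_def algebra_simps)

text \<open>Distinct weights rule out the second alternative of admissibility. Equal weights make
  the index 0 and leave only that alternative, which forces equal values.\<close>

lemma LOP_admissible_imp_order_preserving:
  assumes "LOP_admissible \<epsilon> S X (a, b)"
  defines "w \<equiv> omega_JS \<epsilon> S"
  shows "w a > w b \<Longrightarrow> g_GMX X S a (w a) \<ge> g_GMX X S b (w b)"
    and "w a = w b \<Longrightarrow> g_GMX X S a (w a) = g_GMX X S b (w b)"
  using assms by (auto simp: LOP_admissible_def LOP_idx_def zero_less_mult_iff)

lemma LOP_lambda_eq_1_imp_admissible: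
  assumes "LOP_lambda \<epsilon> S X = 1" "a \<in> {0, 1, 2}" "b \<in> {0, 1, 2}"
  shows "LOP_admissible \<epsilon> S X (a, b)"
proof -
  have "\<forall>p\<in>set [(0, 1), (0, 2), (1, 2)]. LOP_admissible \<epsilon> S X p"
    using assms(1) unfolding LOP_lambda_def LOP_loop_eq_1_iff .
  then show ?thesis
    using assms(2,3) by (auto intro: LOP_admissible_refl LOP_admissible_sym)
qed

lemma locally_order_preserving_alpha_JS:
  assumes "\<epsilon> > 0"
  shows "locally_order_preserving (omega_JS \<epsilon> S) (alpha_JS \<epsilon> S)"
proof -
  \<comment> \<open>Positivity of the common denominator lets it be cancelled from both
    \<open><\<close> and \<open>=\<close> between weights.\<close>
  have "(\<Sum>l=0..2. alpha_JS \<epsilon> S l) > 0"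
    using alpha_JS_pos[OF assms] by (intro sum_pos) auto
  then show ?thesis
    by (auto simp: locally_order_preserving_def omega_JS_def divide_less_cancel)
qed

theorem theorem1:
  fixes u :: "int \<Rightarrow> real" and j :: int and \<epsilon> :: real and X :: wenoz_scheme
  assumes "\<epsilon> > 0"
  shows "locally_order_preserving
           (omega_JS \<epsilon> (stencil_at u j)) (g_LOP_GMX \<epsilon> (stencil_at u j) X)"
proof (cases "LOP_lambda \<epsilon> (stencil_at u j) X = 1")
  case True
  show ?thesis
    unfolding locally_order_preserving_def g_LOP_GMX_def if_P[OF True]
    using LOP_admissible_imp_order_preserving LOP_lambda_eq_1_imp_admissible[OF True]
    by blast
next
  case False
  then have "g_LOP_GMX \<epsilon> (stencil_at u j) X = alpha_JS \<epsilon> (stencil_at u j)"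
    by (simp add: g_LOP_GMX_def fun_eq_iff)
  then show ?thesis
    using locally_order_preserving_alpha_JS[OF assms] by simp
qed

end
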